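(* Let $l\ge 0$ be an integer, and let $\sigma,\tau,w$ on the open interval $(a,b)$ and the complementary polynomials ${\cal P}_\nu(x;l)$ be as in the context. For every $x\in(a,b)$ there is $\epsilon>0$ such that for all real $y$ with $|y|<\epsilon$ we have $x+y\sigma(x)\in(a,b)$, the series ${\cal P}(y,x;l)=\sum_{\nu=0}^{\infty}\frac{y^{\nu}}{\nu!}{\cal P}_{\nu}(x;l)$ converges, $${\cal P}(y,x;l)=\frac{w(x+y\sigma(x))}{w(x)}\left(\frac{\sigma(x+y\sigma(x))}{\sigma(x)}\right)^l,$$ and for every integer $\mu\ge0$ $$\frac{\partial^\mu}{\partial y^\mu}{\cal P}(y,x;l)=\frac{w(x+y\sigma(x))}{w(x)}\left(\frac{\sigma(x+y\sigma(x))}{\sigma(x)}\right)^{l-\mu}{\cal P}_\mu(x+y\sigma(x);l).$$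
   Context: $\sigma(x)=ex^2+2fx+g$ is a real polynomial of degree at most $2$ and $\tau$ is a real polynomial of degree at most $1$. $(a,b)\subseteq\mathbb R$ is a nonempty open (possibly unbounded) interval containing no zero of $\sigma$, and $w:(a,b)\to\mathbb R$ is a differentiable, nowhere vanishing function satisfying Pearson's equation $\sigma(x)w'(x)=[\tau(x)-\sigma'(x)]w(x)$ on $(a,b)$. The complementary polynomials are defined by ${\cal P}_0(x;l)\equiv1$ and, for $\nu\ge0$, ${\cal P}_{\nu+1}(x;l)=\sigma(x)\frac{d}{dx}{\cal P}_\nu(x;l)+[\tau(x)+(l-\nu-1)\sigma'(x)]{\cal P}_\nu(x;l)$. *)

theory Defs
  imports "HOL-Analysis.Analysis" "HOL-Computational_Algebra.Polynomial"
begin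

text \<open>The coefficient \<open>l - \<nu> - 1\<close> is computed in the reals: it becomes negative for \<open>\<nu> \<ge> l\<close>.\<close>

primrec comp_poly :: "real poly \<Rightarrow> real poly \<Rightarrow> nat \<Rightarrow> nat \<Rightarrow> real poly" where
  "comp_poly \<sigma> \<tau> l 0 = 1"
| "comp_poly \<sigma> \<tau> l (Suc \<nu>) =
     \<sigma> * pderiv (comp_poly \<sigma> \<tau> l \<nu>)
     + (\<tau> + smult (real l - real \<nu> - 1) (pderiv \<sigma>)) * comp_poly \<sigma> \<tau> l \<nu>"

definition comp_gen :: "real poly \<Rightarrow> real poly \<Rightarrow> nat \<Rightarrow> real \<Rightarrow> real \<Rightarrow> real" where
  "comp_gen \<sigma> \<tau> l y x = (\<Sum>\<nu>. y ^ \<nu> / fact \<nu> * poly (comp_poly \<sigma> \<tau> l \<nu>) x)"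

end

theory Submission
  imports Defs "HOL-Complex_Analysis.Complex_Analysis"
begin

text \<open>
  Write \<open>F \<mu> y\<close> for the right-hand side of the formula for the \<open>\<mu>\<close>-th derivative.  Pearson's
  equation and the recursion for the complementary polynomials say exactly that
  \<open>(F \<mu>)' = F (\<mu> + 1)\<close>, while \<open>F \<nu> 0 = P\<^sub>\<nu>(x; l)\<close>; so the claimed series is the Taylor series of
  \<open>F 0\<close> at \<open>0\<close>.  It converges to \<open>F 0\<close> because \<open>F 0\<close> solves a linear equation
  \<open>F' = (p / q) F\<close> with polynomials \<open>p\<close>, \<open>q\<close> and \<open>q 0 \<noteq> 0\<close>: if \<open>g\<close> is a complex primitive of
  \<open>p / q\<close> on a disc around \<open>0\<close>, then \<open>F\<close> is a constant multiple of \<open>exp g\<close> on the real line.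
\<close>

text \<open>Since \<open>S\<close> is open, agreement on \<open>S\<close> is agreement near each
  point, so it passes to derivatives and can be iterated. The second conclusion is kept because
  \<open>deriv\<close> is total: its value alone does not show that the derivative exists.\<close>

lemma higher_deriv_eqI:
  fixes F :: "nat \<Rightarrow> 'a::real_normed_field \<Rightarrow> 'a"
  assumes "open S" "t \<in> S"
    and "\<And>t. t \<in> S \<Longrightarrow> f t = F 0 t"
    and F: "\<And>n t. t \<in> S \<Longrightarrow> (F n has_field_derivative F (Suc n) t) (at t)"
  shows "(deriv ^^ n) f t = F n t"
    and "((deriv ^^ n) f has_field_derivative F (Suc n) t) (at t)"
proof -
  have deriv_of_eq: "(g has_field_derivative F (Suc n) t) (at t)"
    if "\<forall>t\<in>S. g t = F n t" "t \<in> S" for g n t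
    by (rule has_field_derivative_transform_within_open[OF F[OF that(2)] \<open>open S\<close> that(2)])
       (use that in auto)
  \<comment> \<open>The induction runs over all of \<open>S\<close> at once, because the next
    derivative at a point needs equality around it.\<close>
  have eq: "\<forall>t\<in>S. (deriv ^^ n) f t = F n t" for n
  proof (induction n)
    case (Suc n)
    then show ?case using deriv_of_eq by (auto intro!: DERIV_imp_deriv)
  qed (use assms in simp)
  then show "(deriv ^^ n) f t = F n t"
    and "((deriv ^^ n) f has_field_derivative F (Suc n) t) (at t)"
    using deriv_of_eq \<open>t \<in> S\<close> by auto
qed

text \<open>Differentiating \<open>n\<close> times moves the \<open>n\<close>-th coefficient,
  multiplied by \<open>fact n\<close>, into the constant term, which is the value at 0. This
  identifies an expansion known only to exist.\<close>

lemma fps_nth_eq_of_derivatives: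
  fixes F :: "nat \<Rightarrow> 'a::{banach,real_normed_field} \<Rightarrow> 'a"
  assumes "F 0 has_fps_expansion A" "open S" "0 \<in> S"
    and F: "\<And>n t. t \<in> S \<Longrightarrow> (F n has_field_derivative F (Suc n) t) (at t)"
  shows "fps_nth A n = F n 0 / fact n"
proof -
  have "F n has_fps_expansion (fps_deriv ^^ n) A"
  proof (induction n)
    case (Suc n)
    have "eventually (\<lambda>t. t \<in> S) (nhds 0)"
      using assms by (intro eventually_nhds_in_open) auto
    \<comment> \<open>An expansion depends only on the germ at 0, so equality of
      \<open>deriv (F n)\<close> and \<open>F (Suc n)\<close> near 0 is enough.\<close>
    then have "eventually (\<lambda>t. deriv (F n) t = F (Suc n) t) (nhds 0)"
      by eventually_elim (auto intro: DERIV_imp_deriv F)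
    moreover have "deriv (F n) has_fps_expansion fps_deriv ((fps_deriv ^^ n) A)"
      by (rule has_fps_expansion_deriv[OF Suc])
    ultimately show ?case
      using has_fps_expansion_cong by force
  qed (use assms in simp)
  then have "F n 0 = fact n * fps_nth A n"
    by (simp add: has_fps_expansion_imp_0_eq_fps_nth_0 fps_0th_higher_deriv)
  then show ?thesis by simp
qed

text \<open>Smoothness of a real function does not make its Taylor series converge to it. The
  passage to the complex disc supplies this, as a holomorphic function is the sum of its Taylor
  series on the whole disc.\<close>

lemma linear_ode_has_fps_expansion:
  fixes f :: "real \<Rightarrow> real" and p q :: "real poly"
  assumes "open S" "0 \<in> S" "poly q 0 \<noteq> 0"
    and f: "\<And>t. t \<in> S \<Longrightarrow>
      (f has_real_derivative poly p t / poly q t * f t) (at t)"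
  shows "\<exists>A. f has_fps_expansion A"
proof -
  define P Q where "P = map_poly complex_of_real p" and "Q = map_poly complex_of_real q"
  have "poly (map_poly complex_of_real p) (of_real t) = of_real (poly p t)" for p t
    by (induction p) (simp_all add: map_poly_pCons)
  then have PQ: "poly P (of_real t) = of_real (poly p t)"
    "poly Q (of_real t) = of_real (poly q t)" for t
    by (simp_all add: P_def Q_def)
  have "open (poly Q -` (- {0}))"
    by (intro open_vimage continuous_intros)
  moreover have "0 \<in> poly Q -` (- {0})"
    using PQ(2)[of 0] \<open>poly q 0 \<noteq> 0\<close> by simp
  ultimately obtain r1 where r1: "r1 > 0" "ball 0 r1 \<subseteq> poly Q -` (- {0})"
    unfolding open_contains_ball by blast
  obtain r2 where r2: "r2 > 0" "ball 0 r2 \<subseteq> S"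
    using \<open>open S\<close> \<open>0 \<in> S\<close> unfolding open_contains_ball by blast
  define r where "r = min r1 r2"
  have "r > 0" using r1 r2 by (simp add: r_def)
  have Q_nz: "poly Q z \<noteq> 0" if "z \<in> ball 0 r" for z
    using that r1 by (auto simp: r_def)
  have S: "t \<in> S" if "\<bar>t\<bar> < r" for t
    using that r2 by (auto simp: r_def)
  have "(\<lambda>z. poly P z / poly Q z) holomorphic_on ball 0 r"
    using Q_nz by (intro holomorphic_intros) auto
  then obtain g where "\<And>z. z \<in> ball 0 r \<Longrightarrow>
      (g has_field_derivative poly P z / poly Q z) (at z within ball 0 r)"
    using holomorphic_convex_primitive'[of "ball 0 r"] by auto
  then have g: "(g has_field_derivative poly P z / poly Q z) (at z)" if "z \<in> ball 0 r" for z
    using that by (metis at_within_open open_ball)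
  \<comment> \<open>Integrating factor: the logarithmic derivatives of \<open>f\<close> and
    \<open>exp (- g)\<close> cancel on the real line. The product is a complex-valued function of a
    real variable, hence the vector derivatives.\<close>
  have "\<exists>c. \<forall>t\<in>ball 0 r. of_real (f t) * exp (- g (of_real t)) = c"
  proof (rule has_vector_derivative_zero_constant[of "ball 0 r"
        "\<lambda>t. of_real (f t) * exp (- g (of_real t))"])
    fix t :: real assume t: "t \<in> ball 0 r"
    have "((\<lambda>t. of_real (f t) :: complex) has_vector_derivative
        of_real (poly p t / poly q t * f t)) (at t)"
      using f[OF S] t by (intro has_vector_derivative_of_real)
        (auto simp: has_real_derivative_iff_has_vector_derivative)
    moreover have "((\<lambda>t. exp (- g (of_real t))) has_vector_derivative
        - exp (- g (of_real t)) * (poly P (of_real t) / poly Q (of_real t))) (at t)"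
    proof -
      have "((\<lambda>z. exp (- g z)) has_field_derivative
          - exp (- g (of_real t)) * (poly P (of_real t) / poly Q (of_real t))) (at (of_real t))"
        using t by (auto intro!: derivative_eq_intros g)
      then show ?thesis
        by (rule has_vector_derivative_real_field)
    qed
    ultimately have "((\<lambda>t. of_real (f t) * exp (- g (of_real t))) has_vector_derivative 0) (at t)"
      by (rule has_vector_derivative_eq_rhs[OF has_vector_derivative_mult]) (simp add: PQ)
    then show "((\<lambda>t. of_real (f t) * exp (- g (of_real t))) has_vector_derivative 0)
        (at t within ball 0 r)"
      by (rule has_vector_derivative_at_within)
  qed auto
  then obtain c where c: "\<And>t. \<bar>t\<bar> < r \<Longrightarrow> of_real (f t) * exp (- g (of_real t)) = c"
    by auto
  define K where "K = (\<lambda>z. c * exp (g z))"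
  \<comment> \<open>Taking real parts gives real coefficients without first showing that those of
    \<open>K\<close> are real. It commutes with the series at real \<open>t\<close>, where the
    powers of \<open>t\<close> are real factors and \<open>K\<close> takes the real value
    \<open>f t\<close>.\<close>
  define A where "A = Abs_fps (\<lambda>n. Re ((deriv ^^ n) K 0 / fact n))"
  have K: "K (of_real t) = of_real (f t)" if "\<bar>t\<bar> < r" for t
    unfolding K_def c[OF that, symmetric] by (simp add: exp_minus)
  have "g holomorphic_on ball 0 r"
    using g unfolding holomorphic_on_open[OF open_ball] by blast
  then have "K holomorphic_on ball 0 r"
    unfolding K_def by (intro holomorphic_intros)
  then have K_sums: "(\<lambda>n. (deriv ^^ n) K 0 / fact n * z ^ n) sums K z" if "z \<in> ball 0 r" for z
    using holomorphic_power_series[of K 0 r z] that by simp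
  have "(\<lambda>n. fps_nth A n * t ^ n) sums f t" if "\<bar>t\<bar> < r" for t
  proof -
    have "(\<lambda>n. (deriv ^^ n) K 0 / fact n * of_real t ^ n) sums K (of_real t)"
      using that by (intro K_sums) auto
    then have "(\<lambda>n. Re ((deriv ^^ n) K 0 / fact n * of_real (t ^ n))) sums Re (of_real (f t))"
      unfolding K[OF that] of_real_power by (rule sums_Re)
    then show ?thesis
      by (simp add: A_def del: of_real_power times_divide_eq_left)
  qed
  moreover have "eventually (\<lambda>t. t \<in> ball 0 r) (nhds 0)"
    using \<open>r > 0\<close> by (intro eventually_nhds_in_open) auto
  ultimately have "f has_fps_expansion A"
    by (intro has_fps_expansionI) (auto elim: eventually_mono)
  then show ?thesis ..
qed

text \<open>Product and chain rule. Pearson's equation turns the derivative of \<open>w\<close> into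
  a multiple of \<tau> - \<sigma>', and the power contributes (l - \<mu>) \<sigma>'. Together they
  give the factor \<tau> + (l - \<mu> - 1) \<sigma>' of the recursion.\<close>

lemma has_real_derivative_weighted_comp_poly:
  fixes \<sigma> \<tau> :: "real poly" and w :: "real \<Rightarrow> real" and x y :: real and l :: nat
  defines "X \<equiv> \<lambda>y. x + y * poly \<sigma> x"
  defines "F \<equiv> \<lambda>\<mu> y. w (X y) / w x * (poly \<sigma> (X y) / poly \<sigma> x) powi (int l - int \<mu>)
    * poly (comp_poly \<sigma> \<tau> l \<mu>) (X y)"
  assumes "poly \<sigma> x \<noteq> 0" "poly \<sigma> (X y) \<noteq> 0" "w differentiable (at (X y))"
    and pearson: "poly \<sigma> (X y) * deriv w (X y) =
      (poly \<tau> (X y) - poly (pderiv \<sigma>) (X y)) * w (X y)"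
  shows "(F \<mu> has_real_derivative F (Suc \<mu>) y) (at y)"
proof -
  define s R k P where "s = poly \<sigma> x" and "R = poly \<sigma> (X y) / s" and "k = int l - int \<mu>"
    and "P = comp_poly \<sigma> \<tau> l \<mu>"
  have nz: "s \<noteq> 0" "R \<noteq> 0" using assms by (auto simp: s_def R_def)
  have "(w has_real_derivative deriv w (X y)) (at (X y))"
    using assms(5) by (simp add: DERIV_deriv_iff_real_differentiable)
  then have w: "((\<lambda>y. w (X y)) has_real_derivative deriv w (X y) * s) (at y)"
    unfolding X_def s_def by (rule DERIV_chain2) (auto intro!: derivative_eq_intros)
  have poly: "((\<lambda>y. poly p (X y)) has_real_derivative poly (pderiv p) (X y) * s) (at y)" for p
    unfolding X_def s_def by (rule DERIV_chain2[OF poly_DERIV]) (auto intro!: derivative_eq_intros)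
  \<comment> \<open>The inner derivative \<open>s\<close> cancels against the denominator
    \<open>s\<close>.\<close>
  have R: "((\<lambda>y. poly \<sigma> (X y) / s) has_real_derivative poly (pderiv \<sigma>) (X y)) (at y)"
    using DERIV_cdivide[OF poly, of \<sigma> s] nz by simp
  have R_powi: "((\<lambda>y. (poly \<sigma> (X y) / s) powi k) has_real_derivative
      of_int k * R powi (k - 1) * poly (pderiv \<sigma>) (X y)) (at y)"
    using DERIV_power_int[OF R, of k] nz by (simp add: R_def)
  have "(F \<mu> has_real_derivative
      (deriv w (X y) * s / w x * R powi k
        + of_int k * R powi (k - 1) * poly (pderiv \<sigma>) (X y) * (w (X y) / w x)) * poly P (X y)
        + poly (pderiv P) (X y) * s * (w (X y) / w x * R powi k)) (at y)"
    unfolding F_def s_def[symmetric] R_def P_def[symmetric] k_def[symmetric]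
    using DERIV_mult[OF DERIV_mult[OF DERIV_cdivide[OF w] R_powi[unfolded R_def]] poly] .
  \<comment> \<open>Splitting off one factor \<open>R\<close> gives all terms the common power
    \<open>R powi (k - 1)\<close> and supplies the \<sigma> that multiplies \<open>w'\<close> in
    Pearson's equation.\<close>
  moreover have "R powi k = R powi (k - 1) * (poly \<sigma> (X y) / s)"
    using nz power_int_minus_mult[of R k] by (simp add: R_def)
  moreover have "F (Suc \<mu>) y = w (X y) / w x * R powi (k - 1) *
      (poly \<sigma> (X y) * poly (pderiv P) (X y)
        + (poly \<tau> (X y) + (of_int k - 1) * poly (pderiv \<sigma>) (X y)) * poly P (X y))"
  proof -
    have "poly (comp_poly \<sigma> \<tau> l (Suc \<mu>)) (X y) = poly \<sigma> (X y) * poly (pderiv P) (X y)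
        + (poly \<tau> (X y) + (of_int k - 1) * poly (pderiv \<sigma>) (X y)) * poly P (X y)"
      by (simp add: k_def P_def)
    moreover have "int l - int (Suc \<mu>) = k - 1"
      by (simp add: k_def)
    ultimately show ?thesis
      unfolding F_def R_def s_def by (simp only: mult.assoc)
  qed
  \<comment> \<open>The remaining identity is pure algebra. The values at \<open>X y\<close> become
    variables (\<open>W\<close> for \<open>w\<close>, \<open>S\<close> for \<sigma>,
    \<open>r\<close> for the common power), so that only Pearson's equation links them.\<close>
  moreover have "(deriv w (X y) * s / w x * (r * (S / s)) + k' * r * S' * (W / w x)) * p
      + p' * s * (W / w x * (r * (S / s)))
    = W / w x * r * (S * p' + (T + (k' - 1) * S') * p)"
    if "S * deriv w (X y) = (T - S') * W" for S S' T W r k' p p' :: real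
  proof -
    have "(deriv w (X y) * s / w x * (r * (S / s)) + k' * r * S' * (W / w x)) * p
        + p' * s * (W / w x * (r * (S / s)))
      = r / w x * ((S * deriv w (X y)) * p + k' * S' * W * p + S * W * p')"
      using nz by (simp add: divide_simps algebra_simps)
    then show ?thesis
      unfolding that by (simp add: divide_simps algebra_simps)
  qed
  note this[OF pearson]
  ultimately show ?thesis
    by (simp only:)
qed

text \<open>Differentiability of every iterated derivative is asserted alongside its value, so that
  the formulas speak of genuine derivatives. The exponent is an integer power because l - \<mu>
  becomes negative for \<mu> > l.\<close>

theorem theorem3:
  fixes e f g :: real and \<sigma> \<tau> :: "real poly" and a b :: ereal
    and w :: "real \<Rightarrow> real" and l :: nat
  assumes sigma: "\<sigma> = [:g, 2 * f, e:]"
    and tau: "degree \<tau> \<le> 1"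
    and interval: "a < b"
    and sigma_nz: "\<And>x. x \<in> einterval a b \<Longrightarrow> poly \<sigma> x \<noteq> 0"
    and w_diff: "\<And>x. x \<in> einterval a b \<Longrightarrow> w differentiable (at x)"
    and w_nz: "\<And>x. x \<in> einterval a b \<Longrightarrow> w x \<noteq> 0"
    and pearson: "\<And>x. x \<in> einterval a b \<Longrightarrow>
      poly \<sigma> x * deriv w x = (poly \<tau> x - poly (pderiv \<sigma>) x) * w x"
  shows "\<forall>x \<in> einterval a b. \<exists>\<epsilon>>0. \<forall>y. \<bar>y\<bar> < \<epsilon> \<longrightarrow>
      x + y * poly \<sigma> x \<in> einterval a b
    \<and> summable (\<lambda>\<nu>. y ^ \<nu> / fact \<nu> * poly (comp_poly \<sigma> \<tau> l \<nu>) x)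
    \<and> comp_gen \<sigma> \<tau> l y x =
        w (x + y * poly \<sigma> x) / w x * (poly \<sigma> (x + y * poly \<sigma> x) / poly \<sigma> x) ^ l
    \<and> (\<forall>\<mu>. (deriv ^^ \<mu>) (\<lambda>t. comp_gen \<sigma> \<tau> l t x) differentiable (at y)
         \<and> (deriv ^^ \<mu>) (\<lambda>t. comp_gen \<sigma> \<tau> l t x) y =
             w (x + y * poly \<sigma> x) / w x
             * (poly \<sigma> (x + y * poly \<sigma> x) / poly \<sigma> x) powi (int l - int \<mu>)
             * poly (comp_poly \<sigma> \<tau> l \<mu>) (x + y * poly \<sigma> x))"
proof
  fix x assume x: "x \<in> einterval a b"
  define s where "s = poly \<sigma> x"
  define S where "S = {y. x + y * s \<in> einterval a b}"
  define F where "F = (\<lambda>\<mu> y. w (x + y * s) / w x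
    * (poly \<sigma> (x + y * s) / s) powi (int l - int \<mu>) * poly (comp_poly \<sigma> \<tau> l \<mu>) (x + y * s))"
  have s: "s \<noteq> 0" using sigma_nz[OF x] by (simp add: s_def)
  have "open S"
    using open_vimage[of "einterval a b" "\<lambda>y. x + y * s", OF open_einterval]
    by (simp add: S_def vimage_def continuous_intros)
  have "0 \<in> S" using x by (simp add: S_def)
  have F_deriv: "(F \<mu> has_real_derivative F (Suc \<mu>) y) (at y)" if "y \<in> S" for \<mu> y
    using that sigma_nz w_diff pearson x unfolding F_def S_def s_def
    by (intro has_real_derivative_weighted_comp_poly) auto
  have F_0: "F n 0 = poly (comp_poly \<sigma> \<tau> l n) x" for n
    using s w_nz[OF x] by (simp add: F_def s_def)
  \<comment> \<open>The quotient of \<open>F 1\<close> by \<open>F 0\<close> is P_1(X) divided by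
    \<sigma>(X) / s, where X = x + y s and P_1 is the first complementary polynomial. Composition
    with \<open>[:x, s:]\<close> makes numerator and denominator polynomials in \<open>y\<close>,
    and \<open>q\<close> takes the value \<open>s\<close> at 0.\<close>
  define p q where "p = smult s (pcompose (comp_poly \<sigma> \<tau> l 1) [:x, s:])"
    and "q = pcompose \<sigma> [:x, s:]"
  have "\<exists>A. F 0 has_fps_expansion A"
  proof (rule linear_ode_has_fps_expansion[OF \<open>open S\<close> \<open>0 \<in> S\<close>])
    show "poly q 0 \<noteq> 0" using s by (simp add: q_def poly_pcompose s_def)
    fix y assume y: "y \<in> S"
    define R where "R = poly \<sigma> (x + y * s) / s"
    have "R \<noteq> 0" using y s sigma_nz by (auto simp: R_def S_def)
    then have "R powi (int l - 1) = R ^ l / R"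
      by (simp add: power_int_diff)
    then have "F (Suc 0) y = poly p y / poly q y * F 0 y"
      unfolding F_def R_def[symmetric]
      by (simp add: p_def q_def poly_pcompose R_def mult_ac)
    then show "(F 0 has_real_derivative poly p y / poly q y * F 0 y) (at y)"
      using F_deriv[OF y, of 0] by simp
  qed
  then obtain A where A: "F 0 has_fps_expansion A" ..
  have A_nth: "fps_nth A n = poly (comp_poly \<sigma> \<tau> l n) x / fact n" for n
    using fps_nth_eq_of_derivatives[OF A \<open>open S\<close> \<open>0 \<in> S\<close> F_deriv] F_0 by simp
  \<comment> \<open>Convergence is secured separately, by staying inside the disc of convergence:
    \<open>eval_fps\<close> is a total infinite sum, so its value alone does not give
    summability.\<close>
  have "eventually (\<lambda>y. y \<in> S \<inter> eball 0 (fps_conv_radius A)) (nhds 0)"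
    using A \<open>open S\<close> \<open>0 \<in> S\<close>
    by (intro eventually_nhds_in_open) (auto simp: has_fps_expansion_def zero_ereal_def)
  moreover have "eventually (\<lambda>y. eval_fps A y = F 0 y) (nhds 0)"
    using A by (simp add: has_fps_expansion_def)
  ultimately have "eventually (\<lambda>y. y \<in> S \<and> summable (\<lambda>n. fps_nth A n * y ^ n)
      \<and> eval_fps A y = F 0 y) (nhds 0)"
    by eventually_elim (auto intro!: summable_fps)
  then obtain \<epsilon> where "\<epsilon> > 0" and \<epsilon>: "\<And>y. \<bar>y\<bar> < \<epsilon> \<Longrightarrow> y \<in> S"
    "\<And>y. \<bar>y\<bar> < \<epsilon> \<Longrightarrow> summable (\<lambda>n. fps_nth A n * y ^ n)"
    "\<And>y. \<bar>y\<bar> < \<epsilon> \<Longrightarrow> eval_fps A y = F 0 y"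
    unfolding eventually_nhds_metric by (auto simp: dist_real_def)
  have terms: "(\<lambda>n. fps_nth A n * y ^ n) =
      (\<lambda>n. y ^ n / fact n * poly (comp_poly \<sigma> \<tau> l n) x)" for y
    by (simp add: A_nth fun_eq_iff)
  have gen: "comp_gen \<sigma> \<tau> l y x = F 0 y" if "\<bar>y\<bar> < \<epsilon>" for y
    using \<epsilon>(3)[OF that] by (simp add: comp_gen_def eval_fps_def terms)
  \<comment> \<open>No termwise differentiation is needed: on the ball of radius \<epsilon> the
    series equals \<open>F 0\<close>, whose successive derivatives are the
    \<open>F \<mu>\<close>.\<close>
  have "(deriv ^^ \<mu>) (\<lambda>t. comp_gen \<sigma> \<tau> l t x) y = F \<mu> y
      \<and> (deriv ^^ \<mu>) (\<lambda>t. comp_gen \<sigma> \<tau> l t x) differentiable (at y)" if "\<bar>y\<bar> < \<epsilon>" for \<mu> y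
    using higher_deriv_eqI[of "ball 0 \<epsilon>" y "\<lambda>t. comp_gen \<sigma> \<tau> l t x" F \<mu>] that gen
      F_deriv[OF \<epsilon>(1)]
    by (auto simp: real_differentiable_def)
  moreover have "F 0 y = w (x + y * s) / w x * (poly \<sigma> (x + y * s) / s) ^ l" for y
    by (simp add: F_def)
  ultimately show "\<exists>\<epsilon>>0. \<forall>y. \<bar>y\<bar> < \<epsilon> \<longrightarrow>
      x + y * poly \<sigma> x \<in> einterval a b
    \<and> summable (\<lambda>\<nu>. y ^ \<nu> / fact \<nu> * poly (comp_poly \<sigma> \<tau> l \<nu>) x)
    \<and> comp_gen \<sigma> \<tau> l y x =
        w (x + y * poly \<sigma> x) / w x * (poly \<sigma> (x + y * poly \<sigma> x) / poly \<sigma> x) ^ l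
    \<and> (\<forall>\<mu>. (deriv ^^ \<mu>) (\<lambda>t. comp_gen \<sigma> \<tau> l t x) differentiable (at y)
         \<and> (deriv ^^ \<mu>) (\<lambda>t. comp_gen \<sigma> \<tau> l t x) y =
             w (x + y * poly \<sigma> x) / w x
             * (poly \<sigma> (x + y * poly \<sigma> x) / poly \<sigma> x) powi (int l - int \<mu>)
             * poly (comp_poly \<sigma> \<tau> l \<mu>) (x + y * poly \<sigma> x))"
    using \<open>\<epsilon> > 0\<close> \<epsilon>(1,2) gen unfolding terms s_def[symmetric]
    by (intro exI[of _ \<epsilon>]) (auto simp: S_def F_def)
qed

end
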